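(* Let $X$ be an ru-complete Archimedean vector lattice and let $(T(t))_{t\ge0}$ be a positive relatively uniformly continuous semigroup on $X$ with generator $A$. Then $A$ is an ru-densely defined and ru-closed operator.
   Context: A net $(x_\alpha)$ in a vector lattice $X$ converges relatively uniformly to $x$ ($x_\alpha\xrightarrow{ru}x$, $\textup{ru-}\lim_\alpha x_\alpha=x$) if there is a regulator $u\in X$ such that for each $\varepsilon>0$ there is $\alpha_0$ with $|x_\alpha-x|\le\varepsilon u$ for all $\alpha\ge\alpha_0$. A sequence is ru-Cauchy if there is $u\in X$ such that for each $\varepsilon>0$ there is $N$ with $|x_n-x_m|\le\varepsilon u$ for all $n,m\ge N$; $X$ is ru-complete if every ru-Cauchy sequence converges relatively uniformly in $X$. A function $f:\mathbb{R}_+\to X$ is ru-continuous if there is $u:\mathbb{R}_+\to X$ such that for each $\varepsilon>0$ there is $\delta>0$ with $|f(t+h)-f(t)|\le\varepsilon u(t)$ for all $t\ge0$ and $h\in[-\min\{\delta,t\},\delta]$. A relatively uniformly continuous semigroup is a family $(T(t))_{t\ge0}$ of linear operators on $X$ with $T(0)=I_X$, $T(t+s)=T(t)T(s)$ for all $s,t\ge0$, and all orbit maps $t\mapsto T(t)x$ ru-continuous; it is positive if every $T(t)$ is a positive operator. Its generator is $Ax:=\textup{ru-}\lim_{h\searrow0}\frac1h(T(h)x-x)$ with domain $D(A)$ the set of all $x\in X$ for which this ru-limit exists in $X$. A set $D\subset X$ is ru-dense if for each $x\in X$ there is a sequence $(x_n)$ in $D$ with $x_n\xrightarrow{ru}x$.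 An operator $P$ with domain $D(P)\subset X$ is ru-densely defined if $D(P)$ is ru-dense, and ru-closed if for sequences $(x_n)$ in $D(P)$, $x_n\xrightarrow{ru}x$ and $Px_n\xrightarrow{ru}y$ imply $x\in D(P)$ and $Px=y$. *)

theory Defs
  imports "HOL-Analysis.Analysis" "HOL-Library.Lattice_Algebras"
begin

class vector_lattice = ordered_real_vector + lattice_ab_group_add_abs

class archimedean_vector_lattice = vector_lattice +
  assumes archimedean: "(\<And>n::nat. n > 0 \<Longrightarrow> real n *\<^sub>R x \<le> y) \<Longrightarrow> x \<le> 0"

text \<open>
  Relative uniform convergence is stated along a filter. For a net, the filter is the one generated
  by the tails of its index set; see \<open>ru_tendsto_sequentially\<close> and \<open>ru_tendsto_at_right_0\<close> below
  for sequences and for the net indexed by decreasing \<open>h > 0\<close>.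
\<close>

definition (in vector_lattice) ru_tendsto :: "('b \<Rightarrow> 'a) \<Rightarrow> 'a \<Rightarrow> 'b filter \<Rightarrow> bool" where
  "ru_tendsto f x F \<longleftrightarrow> (\<exists>u. \<forall>\<epsilon>>0. \<forall>\<^sub>F a in F. \<bar>f a - x\<bar> \<le> \<epsilon> *\<^sub>R u)"

lemma ru_tendsto_sequentially:
  "ru_tendsto X x sequentially \<longleftrightarrow> (\<exists>u. \<forall>\<epsilon>>0. \<exists>N. \<forall>n\<ge>N. \<bar>X n - x\<bar> \<le> \<epsilon> *\<^sub>R u)"
  by (simp add: ru_tendsto_def eventually_sequentially)

lemma ru_tendsto_at_right_0:
  fixes f :: "real \<Rightarrow> 'a::vector_lattice"
  shows "ru_tendsto f x (at_right 0) \<longleftrightarrow>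
    (\<exists>u. \<forall>\<epsilon>>0. \<exists>h\<^sub>0>0. \<forall>h. 0 < h \<and> h \<le> h\<^sub>0 \<longrightarrow> \<bar>f h - x\<bar> \<le> \<epsilon> *\<^sub>R u)"
proof -
  have "(\<forall>\<^sub>F h in at_right 0. P h) \<longleftrightarrow> (\<exists>h\<^sub>0>0. \<forall>h. 0 < h \<and> h \<le> h\<^sub>0 \<longrightarrow> P h)"
    for P :: "real \<Rightarrow> bool"
    unfolding eventually_at_right_field by (meson field_lbound_gt_zero le_less_trans less_imp_le)
  then show ?thesis by (simp add: ru_tendsto_def)
qed

definition (in vector_lattice) ru_Cauchy :: "(nat \<Rightarrow> 'a) \<Rightarrow> bool" where
  "ru_Cauchy X \<longleftrightarrow> (\<exists>u. \<forall>\<epsilon>>0. \<exists>N. \<forall>n\<ge>N. \<forall>m\<ge>N. \<bar>X n - X m\<bar> \<le> \<epsilon> *\<^sub>R u)"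

class ru_complete_archimedean_vector_lattice = archimedean_vector_lattice +
  assumes ru_complete: "ru_Cauchy X \<Longrightarrow> \<exists>x. ru_tendsto X x sequentially"

text \<open>The description is meaningful in the Archimedean case only, by \<open>ru_tendsto_unique\<close>.\<close>

definition ru_Lim :: "'b filter \<Rightarrow> ('b \<Rightarrow> 'a::vector_lattice) \<Rightarrow> 'a" where
  "ru_Lim F f = (THE x. ru_tendsto f x F)"

lemma ru_tendsto_unique:
  fixes f :: "'b \<Rightarrow> 'a::archimedean_vector_lattice"
  assumes "F \<noteq> bot" "ru_tendsto f x F" "ru_tendsto f y F"
  shows "x = y"
proof -
  obtain u v where u: "\<And>\<epsilon>. \<epsilon> > 0 \<Longrightarrow> \<forall>\<^sub>F a in F. \<bar>f a - x\<bar> \<le> \<epsilon> *\<^sub>R u"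
    and v: "\<And>\<epsilon>. \<epsilon> > 0 \<Longrightarrow> \<forall>\<^sub>F a in F. \<bar>f a - y\<bar> \<le> \<epsilon> *\<^sub>R v"
    using assms(2,3) unfolding ru_tendsto_def by blast
  have le: "\<bar>x - y\<bar> \<le> \<epsilon> *\<^sub>R (u + v)" if "\<epsilon> > 0" for \<epsilon> :: real
  proof -
    have "\<forall>\<^sub>F a in F. \<bar>f a - x\<bar> \<le> \<epsilon> *\<^sub>R u \<and> \<bar>f a - y\<bar> \<le> \<epsilon> *\<^sub>R v"
      using u[OF that] v[OF that] by eventually_elim simp
    then obtain a where a: "\<bar>f a - x\<bar> \<le> \<epsilon> *\<^sub>R u" "\<bar>f a - y\<bar> \<le> \<epsilon> *\<^sub>R v"
      using eventually_happens'[OF assms(1)] by blast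
    have "\<bar>x - y\<bar> = \<bar>(f a - y) - (f a - x)\<bar>" by simp
    also have "\<dots> \<le> \<bar>f a - y\<bar> + \<bar>f a - x\<bar>" by (rule abs_triangle_ineq4)
    also have "\<dots> \<le> \<epsilon> *\<^sub>R v + \<epsilon> *\<^sub>R u" using a by (intro add_mono)
    finally show ?thesis by (simp add: scaleR_add_right add.commute)
  qed
  have "real n *\<^sub>R \<bar>x - y\<bar> \<le> u + v" if "n > 0" for n :: nat
  proof -
    have "real n *\<^sub>R \<bar>x - y\<bar> \<le> real n *\<^sub>R (inverse (real n) *\<^sub>R (u + v))"
      using le[of "inverse (real n)"] that by (intro scaleR_left_mono) auto
    then show ?thesis using that by simp
  qed
  then have "\<bar>x - y\<bar> \<le> 0" by (rule archimedean)
  then show ?thesis by simp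
qed

text \<open>
  Functions and families on the nonnegative reals are represented by functions on all of
  \<open>real\<close> whose values at negative arguments are irrelevant.
\<close>

definition ru_continuous :: "(real \<Rightarrow> 'a::vector_lattice) \<Rightarrow> bool" where
  "ru_continuous f \<longleftrightarrow>
    (\<exists>u :: real \<Rightarrow> 'a. \<forall>\<epsilon>>0. \<exists>\<delta>>0. \<forall>t\<ge>0. \<forall>h\<in>{- min \<delta> t..\<delta>}. \<bar>f (t + h) - f t\<bar> \<le> \<epsilon> *\<^sub>R u t)"

definition ru_continuous_semigroup :: "(real \<Rightarrow> 'a::vector_lattice \<Rightarrow> 'a) \<Rightarrow> bool" where
  "ru_continuous_semigroup T \<longleftrightarrow>
    (\<forall>t\<ge>0. linear (T t)) \<and> T 0 = id \<and>
    (\<forall>s\<ge>0. \<forall>t\<ge>0. T (t + s) = T t \<circ> T s) \<and>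
    (\<forall>x. ru_continuous (\<lambda>t. T t x))"

definition positive_operator :: "('a::vector_lattice \<Rightarrow> 'a) \<Rightarrow> bool" where
  "positive_operator S \<longleftrightarrow> linear S \<and> (\<forall>x\<ge>0. S x \<ge> 0)"

definition positive_ru_continuous_semigroup :: "(real \<Rightarrow> 'a::vector_lattice \<Rightarrow> 'a) \<Rightarrow> bool" where
  "positive_ru_continuous_semigroup T \<longleftrightarrow>
    ru_continuous_semigroup T \<and> (\<forall>t\<ge>0. positive_operator (T t))"

definition difference_quotient :: "(real \<Rightarrow> 'a::vector_lattice \<Rightarrow> 'a) \<Rightarrow> 'a \<Rightarrow> real \<Rightarrow> 'a" where
  "difference_quotient T x h = (1 / h) *\<^sub>R (T h x - x)"

definition generator_domain :: "(real \<Rightarrow> 'a::vector_lattice \<Rightarrow> 'a) \<Rightarrow> 'a set" where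
  "generator_domain T = {x. \<exists>y. ru_tendsto (difference_quotient T x) y (at_right 0)}"

definition generator :: "(real \<Rightarrow> 'a::vector_lattice \<Rightarrow> 'a) \<Rightarrow> 'a \<Rightarrow> 'a" where
  "generator T x = ru_Lim (at_right 0) (difference_quotient T x)"

definition ru_dense :: "'a::vector_lattice set \<Rightarrow> bool" where
  "ru_dense D \<longleftrightarrow> (\<forall>x. \<exists>X. (\<forall>n. X n \<in> D) \<and> ru_tendsto X x sequentially)"

text \<open>
  A partially defined operator is given by its domain \<open>D\<close> and a function \<open>P\<close> whose values
  outside \<open>D\<close> are irrelevant.
\<close>

definition operator_on :: "'a::vector_lattice set \<Rightarrow> ('a \<Rightarrow> 'a) \<Rightarrow> bool" where
  "operator_on D P \<longleftrightarrow> subspace D \<and>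
    (\<forall>x\<in>D. \<forall>y\<in>D. P (x + y) = P x + P y) \<and> (\<forall>c. \<forall>x\<in>D. P (c *\<^sub>R x) = c *\<^sub>R P x)"

definition ru_densely_defined :: "'a::vector_lattice set \<Rightarrow> ('a \<Rightarrow> 'a) \<Rightarrow> bool" where
  "ru_densely_defined D P \<longleftrightarrow> ru_dense D"

definition ru_closed :: "'a::vector_lattice set \<Rightarrow> ('a \<Rightarrow> 'a) \<Rightarrow> bool" where
  "ru_closed D P \<longleftrightarrow>
    (\<forall>X x y. (\<forall>n. X n \<in> D) \<and> ru_tendsto X x sequentially \<and>
      ru_tendsto (\<lambda>n. P (X n)) y sequentially \<longrightarrow> x \<in> D \<and> P x = y)"

end

theory Submission
  imports Defs
begin

text \<open>
  Because \<open>T\<close> is positive, an estimate \<open>\<bar>T r x - x\<bar> \<le> \<epsilon> u\<close> for small \<open>r\<close> is carried along the orbit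
  to \<open>\<bar>T (t + r) x - T t x\<bar> \<le> \<epsilon> T t u\<close>, and the orbit of \<open>u\<close> is order bounded on compact intervals
  (\<open>orbit_bounded\<close>). So, although ru-continuity allows the regulator to vary with \<open>t\<close>, an orbit is
  uniformly continuous on \<open>[0, s]\<close> with respect to one regulator \<open>W\<close>. The classical proof for strongly
  continuous semigroups can then be followed, with order estimates in place of norms and the
  Archimedean property to discard errors of the form \<open>\<eta> W\<close> with arbitrarily small \<open>\<eta>\<close>. The integral of
  an orbit \<open>t \<mapsto> T t x\<close> over \<open>[0, s]\<close> enters only through its equidistant Riemann sums \<open>R n\<close>.
  
  The generator \<open>A\<close> is closed because \<open>T s z - z\<close> is the integral of \<open>T t (A z)\<close> for \<open>z\<close> in the domain
  (\<open>riemann_sum_generator\<close>, a telescoping sum). If \<open>X n\<close> converges to \<open>x\<close> and \<open>A (X n)\<close> to \<open>y\<close>, then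
  for \<open>t \<le> h\<close> with \<open>h\<close> small the orbit of \<open>A (X n)\<close> stays within \<open>\<eta> W + \<epsilon> u\<close> of \<open>y\<close>, so
  \<open>T h (X n) - X n\<close> is within \<open>h (\<eta> W + \<epsilon> u)\<close> of \<open>h y\<close>. Letting \<open>n\<close> grow leaves
  \<open>\<bar>T h x - x - h y\<bar> \<le> h \<epsilon> u\<close>, where \<open>u\<close> is the regulator of the orbit of \<open>y\<close> at \<open>0\<close>.
  
  The domain is dense because the mean \<open>(1 / s) \<integral>\<^sub>0\<^sup>s T t x dt\<close> tends to \<open>x\<close> as \<open>s\<close> decreases to \<open>0\<close>. The
  integral exists by ru-completeness, since refining a partition changes a Riemann sum little
  (\<open>ru_Cauchy_riemann_sum\<close>). It lies in the domain (\<open>riemann_limit_in_domain\<close>) because \<open>T h\<close> shifts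
  the nodes of the Riemann sum, so all but the terms near the two ends cancel in
  \<open>T h (R n) - R n\<close>, and what remains is approximately \<open>h (T s x - x)\<close>.
\<close>

section \<open>Estimates in vector lattices\<close>

lemma abs_scaleR_le:
  fixes x :: "'a::vector_lattice"
  assumes "\<bar>x\<bar> \<le> b" "0 \<le> c"
  shows "\<bar>c *\<^sub>R x\<bar> \<le> c *\<^sub>R b"
proof (rule abs_leI)
  have "x \<le> b" "- x \<le> b" using assms(1) abs_le_D1 abs_le_D2 by auto
  then show "c *\<^sub>R x \<le> c *\<^sub>R b" and "- (c *\<^sub>R x) \<le> c *\<^sub>R b"
    using scaleR_left_mono[OF _ assms(2)] by (auto simp flip: scaleR_minus_right)
qed

lemma abs_add_le:
  fixes x :: "'a::vector_lattice"
  assumes "\<bar>x\<bar> \<le> a" "\<bar>y\<bar> \<le> b"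
  shows "\<bar>x + y\<bar> \<le> a + b"
  using abs_triangle_ineq[of x y] add_mono[OF assms] by (rule order_trans)

lemma abs_diff_le:
  fixes x :: "'a::vector_lattice"
  assumes "\<bar>x\<bar> \<le> a" "\<bar>y\<bar> \<le> b"
  shows "\<bar>x - y\<bar> \<le> a + b"
  using abs_triangle_ineq4[of x y] add_mono[OF assms] by (rule order_trans)

lemma abs_sum_le:
  fixes f :: "nat \<Rightarrow> 'a::vector_lattice"
  assumes "\<And>k. k < n \<Longrightarrow> \<bar>f k\<bar> \<le> b"
  shows "\<bar>\<Sum>k<n. f k\<bar> \<le> real n *\<^sub>R b"
  using assms
proof (induction n)
  case (Suc n)
  then have "\<bar>(\<Sum>k<n. f k) + f n\<bar> \<le> real n *\<^sub>R b + b" by (intro abs_add_le) auto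
  then show ?case by (simp add: scaleR_add_left add.commute)
qed simp

text \<open>
  This is how the Archimedean property is used: it replaces the limit \<open>\<epsilon> \<rightarrow> 0\<close> in inequalities.
\<close>

lemma le_if_le_add_scaleR:
  fixes a b w :: "'a::archimedean_vector_lattice"
  assumes "\<And>\<epsilon>. \<epsilon> > 0 \<Longrightarrow> a \<le> b + \<epsilon> *\<^sub>R w"
  shows "a \<le> b"
proof -
  have "real n *\<^sub>R (a - b) \<le> w" if "n > 0" for n :: nat
  proof -
    have "a - b \<le> inverse (real n) *\<^sub>R w"
      using assms[of "inverse (real n)"] that by (simp add: algebra_simps)
    then have "real n *\<^sub>R (a - b) \<le> real n *\<^sub>R (inverse (real n) *\<^sub>R w)"
      by (rule scaleR_left_mono) simp
    then show ?thesis using that by simp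
  qed
  then have "a - b \<le> 0" by (rule archimedean)
  then show ?thesis by simp
qed

section \<open>Relatively uniform limits\<close>

lemma ru_tendsto_add:
  fixes x :: "'a::vector_lattice"
  assumes "ru_tendsto f x F" "ru_tendsto g y F"
  shows "ru_tendsto (\<lambda>a. f a + g a) (x + y) F"
proof -
  obtain u where u: "\<And>\<epsilon>. \<epsilon> > 0 \<Longrightarrow> \<forall>\<^sub>F a in F. \<bar>f a - x\<bar> \<le> \<epsilon> *\<^sub>R u"
    using assms(1) unfolding ru_tendsto_def by blast
  obtain v where v: "\<And>\<epsilon>. \<epsilon> > 0 \<Longrightarrow> \<forall>\<^sub>F a in F. \<bar>g a - y\<bar> \<le> \<epsilon> *\<^sub>R v"
    using assms(2) unfolding ru_tendsto_def by blast
  have "\<forall>\<^sub>F a in F. \<bar>f a + g a - (x + y)\<bar> \<le> \<epsilon> *\<^sub>R (u + v)" if "\<epsilon> > 0" for \<epsilon>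
    using u[OF that] v[OF that]
  proof eventually_elim
    case (elim a)
    then show ?case using abs_add_le[OF elim] by (simp add: algebra_simps)
  qed
  then show ?thesis unfolding ru_tendsto_def by blast
qed

lemma ru_tendsto_scaleR:
  fixes x :: "'a::vector_lattice"
  assumes "ru_tendsto f x F"
  shows "ru_tendsto (\<lambda>a. c *\<^sub>R f a) (c *\<^sub>R x) F"
proof -
  obtain u where u: "\<And>\<epsilon>. \<epsilon> > 0 \<Longrightarrow> \<forall>\<^sub>F a in F. \<bar>f a - x\<bar> \<le> \<epsilon> *\<^sub>R u"
    using assms unfolding ru_tendsto_def by blast
  have "\<forall>\<^sub>F a in F. \<bar>c *\<^sub>R f a - c *\<^sub>R x\<bar> \<le> \<epsilon> *\<^sub>R (\<bar>c\<bar> *\<^sub>R u)" if "\<epsilon> > 0" for \<epsilon>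
    using u[OF that]
  proof eventually_elim
    case (elim a)
    then have "\<bar>\<bar>c\<bar> *\<^sub>R (f a - x)\<bar> \<le> \<bar>c\<bar> *\<^sub>R \<epsilon> *\<^sub>R u" by (intro abs_scaleR_le) auto
    moreover have "\<bar>c *\<^sub>R f a - c *\<^sub>R x\<bar> = \<bar>\<bar>c\<bar> *\<^sub>R (f a - x)\<bar>"
      by (cases "c \<ge> 0") (auto simp: scaleR_diff_right abs_minus_commute)
    ultimately show ?case by (simp add: mult.commute)
  qed
  then show ?thesis unfolding ru_tendsto_def by blast
qed

lemma ru_tendsto_diff:
  fixes x :: "'a::vector_lattice"
  assumes "ru_tendsto f x F" "ru_tendsto g y F"
  shows "ru_tendsto (\<lambda>a. f a - g a) (x - y) F"
  using ru_tendsto_add[OF assms(1) ru_tendsto_scaleR[OF assms(2), of "-1"]] by simp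

text \<open>
  The slack \<open>\<eta> w\<close> makes it possible to pass to the limit in an estimate whose error terms vanish along
  the filter only up to a regulator.
\<close>

lemma ru_limit_abs_diff_le:
  fixes f :: "'b \<Rightarrow> 'a::archimedean_vector_lattice"
  assumes "F \<noteq> bot" "ru_tendsto f x F"
    and bound: "\<And>\<eta>. \<eta> > 0 \<Longrightarrow> \<forall>\<^sub>F a in F. \<bar>f a - z\<bar> \<le> b + \<eta> *\<^sub>R w"
  shows "\<bar>x - z\<bar> \<le> b"
proof -
  obtain u where u: "\<And>\<epsilon>. \<epsilon> > 0 \<Longrightarrow> \<forall>\<^sub>F a in F. \<bar>f a - x\<bar> \<le> \<epsilon> *\<^sub>R u"
    using assms(2) unfolding ru_tendsto_def by blast
  have "\<bar>x - z\<bar> \<le> b + \<eta> *\<^sub>R (w + u)" if "\<eta> > 0" for \<eta>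
  proof -
    obtain a where "\<bar>f a - z\<bar> \<le> b + \<eta> *\<^sub>R w" "\<bar>f a - x\<bar> \<le> \<eta> *\<^sub>R u"
      using eventually_happens'[OF assms(1) eventually_conj[OF bound u]] \<open>\<eta> > 0\<close> by blast
    from abs_diff_le[OF this] show ?thesis by (simp add: algebra_simps)
  qed
  then show ?thesis by (rule le_if_le_add_scaleR)
qed

text \<open>
  Multiplying by \<open>h\<close> removes the division from the definition of the derivative; all later estimates
  bound \<open>T h x - x - h y\<close>.
\<close>

lemma ru_tendsto_difference_quotient_iff:
  "ru_tendsto (difference_quotient T x) y (at_right 0) \<longleftrightarrow>
    (\<exists>u. \<forall>\<epsilon>>0. \<exists>\<delta>>0. \<forall>h. 0 < h \<and> h \<le> \<delta> \<longrightarrow> \<bar>T h x - x - h *\<^sub>R y\<bar> \<le> h *\<^sub>R \<epsilon> *\<^sub>R u)"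
proof -
  have "\<bar>difference_quotient T x h - y\<bar> \<le> b \<longleftrightarrow> \<bar>T h x - x - h *\<^sub>R y\<bar> \<le> h *\<^sub>R b"
    if "h > 0" for h b
  proof
    have *: "T h x - x - h *\<^sub>R y = h *\<^sub>R (difference_quotient T x h - y)"
      using that by (simp add: difference_quotient_def scaleR_diff_right)
    show "\<bar>T h x - x - h *\<^sub>R y\<bar> \<le> h *\<^sub>R b" if "\<bar>difference_quotient T x h - y\<bar> \<le> b"
      unfolding * using that \<open>h > 0\<close> by (intro abs_scaleR_le) auto
    assume "\<bar>T h x - x - h *\<^sub>R y\<bar> \<le> h *\<^sub>R b"
    then have "\<bar>(1 / h) *\<^sub>R (T h x - x - h *\<^sub>R y)\<bar> \<le> (1 / h) *\<^sub>R h *\<^sub>R b"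
      using that by (intro abs_scaleR_le) auto
    then show "\<bar>difference_quotient T x h - y\<bar> \<le> b"
      unfolding * using that by simp
  qed
  then show ?thesis unfolding ru_tendsto_at_right_0 by meson
qed

lemma generator_eqI:
  fixes T :: "real \<Rightarrow> 'a::archimedean_vector_lattice \<Rightarrow> 'a"
  assumes "ru_tendsto (difference_quotient T x) y (at_right 0)"
  shows "x \<in> generator_domain T" "generator T x = y"
  using assms ru_tendsto_unique[OF trivial_limit_at_right_real]
  unfolding generator_domain_def generator_def ru_Lim_def by blast+

lemma ru_tendsto_generator:
  fixes T :: "real \<Rightarrow> 'a::archimedean_vector_lattice \<Rightarrow> 'a"
  assumes "x \<in> generator_domain T"
  shows "ru_tendsto (difference_quotient T x) (generator T x) (at_right 0)"
  using assms generator_eqI(2) unfolding generator_domain_def by blast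

lemma eventually_mesh_le:
  assumes "\<delta> > 0"
  shows "\<forall>\<^sub>F n in sequentially. n > 0 \<and> s / real n \<le> \<delta>"
proof -
  have "(\<lambda>n. s / real n) \<longlonglongrightarrow> 0" by (rule lim_const_over_n)
  then have "\<forall>\<^sub>F n in sequentially. s / real n < \<delta>" using assms by (rule order_tendstoD)
  then show ?thesis
    using eventually_gt_at_top[of 0] by eventually_elim auto
qed

section \<open>Orbits of positive semigroups\<close>

locale positive_ru_semigroup =
  fixes T :: "real \<Rightarrow> 'a::archimedean_vector_lattice \<Rightarrow> 'a"
  assumes semigroup: "positive_ru_continuous_semigroup T"
begin

lemma linear_T: "t \<ge> 0 \<Longrightarrow> linear (T t)"
  using semigroup
  by (simp add: positive_ru_continuous_semigroup_def ru_continuous_semigroup_def)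

lemma T_0 [simp]: "T 0 x = x"
  using semigroup
  by (simp add: positive_ru_continuous_semigroup_def ru_continuous_semigroup_def)

lemma T_add: "s \<ge> 0 \<Longrightarrow> t \<ge> 0 \<Longrightarrow> T (t + s) x = T t (T s x)"
  using semigroup
  by (simp add: positive_ru_continuous_semigroup_def ru_continuous_semigroup_def)

lemmas T_linear_simps = linear_add[OF linear_T] linear_diff[OF linear_T]
  linear_scale[OF linear_T] linear_sum[OF linear_T]

lemma T_nonneg: "t \<ge> 0 \<Longrightarrow> x \<ge> 0 \<Longrightarrow> T t x \<ge> 0"
  using semigroup by (simp add: positive_ru_continuous_semigroup_def positive_operator_def)

lemma T_mono:
  assumes "t \<ge> 0" "x \<le> y"
  shows "T t x \<le> T t y"
  using T_nonneg[of t "y - x"] assms by (simp add: T_linear_simps)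

lemma abs_T_le:
  assumes "t \<ge> 0" "\<bar>x\<bar> \<le> b"
  shows "\<bar>T t x\<bar> \<le> T t b"
proof (rule abs_leI)
  show "T t x \<le> T t b" using assms abs_le_D1 by (blast intro: T_mono)
  have "T t (- x) \<le> T t b" using assms abs_le_D2 by (blast intro: T_mono)
  then show "- T t x \<le> T t b" using linear_neg[OF linear_T[OF assms(1)]] by simp
qed

lemma ru_tendsto_T:
  assumes "t \<ge> 0" "ru_tendsto f x F"
  shows "ru_tendsto (\<lambda>a. T t (f a)) (T t x) F"
proof -
  obtain u where u: "\<And>\<epsilon>. \<epsilon> > 0 \<Longrightarrow> \<forall>\<^sub>F a in F. \<bar>f a - x\<bar> \<le> \<epsilon> *\<^sub>R u"
    using assms(2) unfolding ru_tendsto_def by blast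
  have "\<forall>\<^sub>F a in F. \<bar>T t (f a) - T t x\<bar> \<le> \<epsilon> *\<^sub>R T t u" if "\<epsilon> > 0" for \<epsilon>
    using u[OF that]
  proof eventually_elim
    case (elim a)
    then show ?case using abs_T_le[OF assms(1) elim] assms(1) by (simp add: T_linear_simps)
  qed
  then show ?thesis unfolding ru_tendsto_def by blast
qed

text \<open>
  With the \<open>\<delta>\<close> belonging to \<open>\<epsilon> = 1\<close>, each point of \<open>[0, s]\<close> lies within \<open>\<delta>\<close> to the right of one of
  finitely many multiples of \<open>\<delta>\<close>. The regulators and orbit values at these multiples add up to a bound.
\<close>

lemma orbit_bounded:
  obtains W where "\<And>t. 0 \<le> t \<Longrightarrow> t \<le> s \<Longrightarrow> \<bar>T t x\<bar> \<le> W"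
proof -
  have "ru_continuous (\<lambda>t. T t x)"
    using semigroup
    by (simp add: positive_ru_continuous_semigroup_def ru_continuous_semigroup_def)
  then obtain u :: "real \<Rightarrow> 'a" and \<delta> where \<delta>: "\<delta> > 0" and
    u: "\<And>t h. t \<ge> 0 \<Longrightarrow> - min \<delta> t \<le> h \<Longrightarrow> h \<le> \<delta> \<Longrightarrow> \<bar>T (t + h) x - T t x\<bar> \<le> u t"
    unfolding ru_continuous_def
    by (metis atLeastAtMost_iff less_numeral_extra(1) scaleR_one)
  define B where "B k = \<bar>u (real k * \<delta>)\<bar> + \<bar>T (real k * \<delta>) x\<bar>" for k :: nat
  have "\<bar>T t x\<bar> \<le> (\<Sum>k\<le>nat \<lfloor>s / \<delta>\<rfloor>. B k)" if t: "0 \<le> t" "t \<le> s" for t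
  proof -
    define k where "k = nat \<lfloor>t / \<delta>\<rfloor>"
    have k: "real k \<le> t / \<delta>" "t / \<delta> < real k + 1"
      using t \<delta> by (simp_all add: k_def)
    then have r: "0 \<le> t - real k * \<delta>" "t - real k * \<delta> \<le> \<delta>"
      using \<delta> by (auto simp: field_simps)
    have "\<bar>T (real k * \<delta> + (t - real k * \<delta>)) x - T (real k * \<delta>) x\<bar> \<le> u (real k * \<delta>)"
      using r \<delta> t by (intro u) auto
    then have "\<bar>T t x - T (real k * \<delta>) x\<bar> \<le> \<bar>u (real k * \<delta>)\<bar>"
      by (auto intro: order_trans abs_ge_self)
    from abs_add_le[OF this order_refl[of "\<bar>T (real k * \<delta>) x\<bar>"]]
    have "\<bar>T t x\<bar> \<le> B k" by (simp add: B_def)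
    also have "B k = sum B {k}" by simp
    also have "\<dots> \<le> (\<Sum>k\<le>nat \<lfloor>s / \<delta>\<rfloor>. B k)"
    proof (rule sum_mono2)
      show "{k} \<subseteq> {..nat \<lfloor>s / \<delta>\<rfloor>}"
        using t \<delta> by (auto simp: k_def intro!: nat_mono floor_mono divide_right_mono)
    qed (auto simp: B_def)
    finally show ?thesis .
  qed
  then show thesis by (rule that)
qed

text \<open>
  The semigroup law turns this one-point statement into uniform continuity on compact intervals, so
  it is the only form of ru-continuity required besides \<open>orbit_bounded\<close>.
\<close>

lemma orbit_continuous_at_0:
  obtains u where "u \<ge> 0"
    "\<And>\<epsilon>. \<epsilon> > 0 \<Longrightarrow> \<exists>\<delta>>0. \<forall>h. 0 \<le> h \<and> h \<le> \<delta> \<longrightarrow> \<bar>T h x - x\<bar> \<le> \<epsilon> *\<^sub>R u"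
proof -
  have "ru_continuous (\<lambda>t. T t x)"
    using semigroup
    by (simp add: positive_ru_continuous_semigroup_def ru_continuous_semigroup_def)
  then obtain u :: "real \<Rightarrow> 'a" where
    u: "\<And>\<epsilon>. \<epsilon> > 0 \<Longrightarrow> \<exists>\<delta>>0. \<forall>t\<ge>0. \<forall>h\<in>{- min \<delta> t..\<delta>}. \<bar>T (t + h) x - T t x\<bar> \<le> \<epsilon> *\<^sub>R u t"
    unfolding ru_continuous_def by blast
  show thesis
  proof
    show "\<bar>u 0\<bar> \<ge> 0" by simp
    fix \<epsilon> :: real
    assume "\<epsilon> > 0"
    then obtain \<delta> where \<delta>: "\<delta> > 0"
      "\<And>t h. t \<ge> 0 \<Longrightarrow> h \<in> {- min \<delta> t..\<delta>} \<Longrightarrow> \<bar>T (t + h) x - T t x\<bar> \<le> \<epsilon> *\<^sub>R u t"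
      using u by meson
    have "\<bar>T h x - x\<bar> \<le> \<epsilon> *\<^sub>R \<bar>u 0\<bar>" if "0 \<le> h" "h \<le> \<delta>" for h
    proof -
      have "\<bar>T h x - x\<bar> \<le> \<epsilon> *\<^sub>R u 0" using \<delta>(2)[of 0 h] \<delta>(1) that by simp
      also have "\<dots> \<le> \<epsilon> *\<^sub>R \<bar>u 0\<bar>" using \<open>\<epsilon> > 0\<close> abs_ge_self by (intro scaleR_left_mono) auto
      finally show ?thesis .
    qed
    then show "\<exists>\<delta>>0. \<forall>h. 0 \<le> h \<and> h \<le> \<delta> \<longrightarrow> \<bar>T h x - x\<bar> \<le> \<epsilon> *\<^sub>R \<bar>u 0\<bar>"
      using \<delta>(1) by blast
  qed
qed

section \<open>Riemann sums of orbits\<close>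

definition riemann_sum :: "real \<Rightarrow> 'a \<Rightarrow> nat \<Rightarrow> 'a" where
  "riemann_sum s x n = (s / real n) *\<^sub>R (\<Sum>k<n. T (real k * (s / real n)) x)"

lemma abs_mesh_sum_le:
  assumes "s \<ge> 0" "n > 0" "\<And>k. k < n \<Longrightarrow> \<bar>f k\<bar> \<le> (b :: 'a)"
  shows "\<bar>(s / real n) *\<^sub>R (\<Sum>k<n. f k)\<bar> \<le> s *\<^sub>R b"
  using abs_scaleR_le[OF abs_sum_le[of n f b], of "s / real n"] assms by simp

lemma node_bounds:
  assumes "s \<ge> 0" "k < n"
  shows "0 \<le> real k * (s / real n)" "real k * (s / real n) \<le> s"
proof -
  have "real k * s \<le> real n * s" using assms by (intro mult_right_mono) auto
  then show "real k * (s / real n) \<le> s" using assms by (simp add: field_simps)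
qed (use assms in auto)

text \<open>
  This plays the part of the mean value inequality
  \<open>\<bar>\<integral>\<^sub>0\<^sup>s T t x dt - s w\<bar> \<le> s sup \<bar>T t x - w\<bar>\<close>; an upper bound \<open>b\<close> replaces the supremum.
\<close>

lemma abs_riemann_sum_le:
  assumes "s \<ge> 0" "n > 0" "\<And>t. 0 \<le> t \<Longrightarrow> t \<le> s \<Longrightarrow> \<bar>T t x - w\<bar> \<le> b"
  shows "\<bar>riemann_sum s x n - s *\<^sub>R w\<bar> \<le> s *\<^sub>R b"
proof -
  have "riemann_sum s x n - s *\<^sub>R w = (s / real n) *\<^sub>R (\<Sum>k<n. T (real k * (s / real n)) x - w)"
    using assms(2) by (simp add: riemann_sum_def sum_subtractf scaleR_diff_right sum_constant_scaleR)
  then show ?thesis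
    using abs_mesh_sum_le[OF assms(1,2), of "\<lambda>k. T (real k * (s / real n)) x - w" b]
      assms(3) node_bounds[OF assms(1)] by simp
qed

lemma telescope_T:
  assumes "d \<ge> 0"
  shows "(\<Sum>k<n. T (real k * d) (T d z - z)) = T (real n * d) z - z"
proof (induction n)
  case (Suc n)
  have "T (real (Suc n) * d) z = T (real n * d) (T d z)"
    using T_add[of d "real n * d" z] assms by (simp add: algebra_simps)
  then show ?case using Suc assms by (simp add: T_linear_simps)
qed simp

text \<open>
  The fundamental theorem of calculus, \<open>T s z - z = \<integral>\<^sub>0\<^sup>s T t (A z) dt\<close>. With step \<open>d = s / n\<close>, the left
  side telescopes into the sum of \<open>T (k d) (T d z - z)\<close>, and \<open>T d z - z\<close> differs from \<open>d A z\<close> by at most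
  \<open>d \<epsilon> u\<close>. The \<open>n\<close> errors, moved along the orbit of \<open>u\<close>, add up to at most \<open>s \<epsilon> W\<close>.
\<close>

lemma riemann_sum_generator:
  assumes "s > 0" "z \<in> generator_domain T"
  shows "ru_tendsto (riemann_sum s (generator T z)) (T s z - z) sequentially"
proof -
  let ?y = "generator T z"
  obtain u where u: "\<And>\<epsilon>. \<epsilon> > 0 \<Longrightarrow>
      \<exists>\<delta>>0. \<forall>h. 0 < h \<and> h \<le> \<delta> \<longrightarrow> \<bar>T h z - z - h *\<^sub>R ?y\<bar> \<le> h *\<^sub>R \<epsilon> *\<^sub>R u"
    using ru_tendsto_generator[OF assms(2)] unfolding ru_tendsto_difference_quotient_iff by blast
  obtain W where W: "\<And>t. 0 \<le> t \<Longrightarrow> t \<le> s \<Longrightarrow> \<bar>T t u\<bar> \<le> W"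
    using orbit_bounded by blast
  have "\<forall>\<^sub>F n in sequentially. \<bar>riemann_sum s ?y n - (T s z - z)\<bar> \<le> \<epsilon> *\<^sub>R (s *\<^sub>R W)"
    if "\<epsilon> > 0" for \<epsilon>
  proof -
    obtain \<delta> where \<delta>: "\<delta> > 0"
      "\<And>h. 0 < h \<Longrightarrow> h \<le> \<delta> \<Longrightarrow> \<bar>T h z - z - h *\<^sub>R ?y\<bar> \<le> h *\<^sub>R \<epsilon> *\<^sub>R u"
      using u[OF \<open>\<epsilon> > 0\<close>] by blast
    show ?thesis
      using eventually_mesh_le[OF \<delta>(1), of s]
    proof eventually_elim
      case (elim n)
      define d where "d = s / real n"
      have d: "d > 0" "d \<le> \<delta>" and n: "n > 0" "real n * d = s"
        using elim assms(1) by (auto simp: d_def)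
      let ?e = "T d z - z - d *\<^sub>R ?y"
      have "\<bar>T (real k * d) ?e\<bar> \<le> d *\<^sub>R \<epsilon> *\<^sub>R W" if "k < n" for k
      proof -
        have k: "0 \<le> real k * d" "real k * d \<le> s"
          using node_bounds[of s k n] that assms(1) by (auto simp: d_def)
        have "\<bar>T (real k * d) ?e\<bar> \<le> T (real k * d) (d *\<^sub>R \<epsilon> *\<^sub>R u)"
          using abs_T_le[OF k(1) \<delta>(2)[OF d]] .
        also have "\<dots> = d *\<^sub>R \<epsilon> *\<^sub>R T (real k * d) u" using k(1) by (simp add: T_linear_simps)
        also have "\<dots> \<le> d *\<^sub>R \<epsilon> *\<^sub>R W"
          using W[OF k] d(1) \<open>\<epsilon> > 0\<close> abs_ge_self by (intro scaleR_left_mono) (auto intro: order_trans)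
        finally show ?thesis .
      qed
      then have "\<bar>\<Sum>k<n. T (real k * d) ?e\<bar> \<le> real n *\<^sub>R d *\<^sub>R \<epsilon> *\<^sub>R W"
        by (rule abs_sum_le)
      also have "(\<Sum>k<n. T (real k * d) ?e) =
          (\<Sum>k<n. T (real k * d) (T d z - z)) - d *\<^sub>R (\<Sum>k<n. T (real k * d) ?y)"
        using d(1) by (simp add: T_linear_simps sum_subtractf scaleR_sum_right)
      also have "\<dots> = T s z - z - riemann_sum s ?y n"
        using telescope_T[of d z n] d(1) n by (simp add: riemann_sum_def d_def)
      also have "real n *\<^sub>R d *\<^sub>R \<epsilon> *\<^sub>R W = \<epsilon> *\<^sub>R (s *\<^sub>R W)"
        using n(2) by (simp add: algebra_simps)
      finally show ?case by (simp add: abs_minus_commute)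
    qed
  qed
  then show ?thesis unfolding ru_tendsto_def by blast
qed

text \<open>
  The refined sum splits into \<open>n\<close> translates, by multiples of \<open>d = s / n\<close>, of a Riemann sum over
  \<open>[0, d]\<close>; that short sum is close to \<open>d x\<close>, since the orbit has hardly left \<open>x\<close> by time \<open>d\<close>.
\<close>

lemma riemann_sum_refine:
  assumes "s \<ge> 0" "n > 0" "m > 0"
    and close: "\<And>r. 0 \<le> r \<Longrightarrow> r \<le> s / real n \<Longrightarrow> \<bar>T r x - x\<bar> \<le> \<epsilon> *\<^sub>R u"
    and W: "\<And>t. 0 \<le> t \<Longrightarrow> t \<le> s \<Longrightarrow> \<bar>T t u\<bar> \<le> W" and "\<epsilon> \<ge> 0"
  shows "\<bar>riemann_sum s x (n * m) - riemann_sum s x n\<bar> \<le> \<epsilon> *\<^sub>R (s *\<^sub>R W)"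
proof -
  define d where "d = s / real n"
  have d: "d \<ge> 0" using assms(1) by (simp add: d_def)
  let ?r = "riemann_sum d x m - d *\<^sub>R x"
  have mesh: "s / real (n * m) = d / real m" by (simp add: d_def)
  have "(\<Sum>k<n * m. T (real k * (d / real m)) x) =
      (\<Sum>q<n. \<Sum>k\<in>{q * m..<q * m + m}. T (real k * (d / real m)) x)"
    by (rule sum.nat_group[symmetric])
  also have "\<dots> = (\<Sum>q<n. T (real q * d) (\<Sum>k<m. T (real k * (d / real m)) x))"
  proof (rule sum.cong[OF refl])
    fix q
    have "(\<Sum>k\<in>{q * m..<q * m + m}. T (real k * (d / real m)) x) =
        (\<Sum>k<m. T (real (k + q * m) * (d / real m)) x)"
      using sum.shift_bounds_nat_ivl[of "\<lambda>k. T (real k * (d / real m)) x" 0 "q * m" m]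
      by (simp add: add.commute lessThan_atLeast0)
    also have "\<dots> = (\<Sum>k<m. T (real q * d) (T (real k * (d / real m)) x))"
    proof (rule sum.cong[OF refl])
      fix k
      have "real (k + q * m) * (d / real m) = real q * d + real k * (d / real m)"
        using assms(3) by (simp add: field_simps)
      then show "T (real (k + q * m) * (d / real m)) x = T (real q * d) (T (real k * (d / real m)) x)"
        using d by (simp add: T_add)
    qed
    finally show "(\<Sum>k\<in>{q * m..<q * m + m}. T (real k * (d / real m)) x) =
        T (real q * d) (\<Sum>k<m. T (real k * (d / real m)) x)"
      using d by (simp add: T_linear_simps)
  qed
  finally have "riemann_sum s x (n * m) = (\<Sum>q<n. T (real q * d) (riemann_sum d x m))"
    using d unfolding riemann_sum_def mesh by (simp add: T_linear_simps scaleR_sum_right)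
  then have diff: "riemann_sum s x (n * m) - riemann_sum s x n = (\<Sum>q<n. T (real q * d) ?r)"
    using d by (simp add: riemann_sum_def[of s x n] d_def[symmetric] T_linear_simps sum_subtractf
        scaleR_sum_right)
  have r: "\<bar>?r\<bar> \<le> d *\<^sub>R \<epsilon> *\<^sub>R u"
    using abs_riemann_sum_le[of d m x x "\<epsilon> *\<^sub>R u"] d assms(3) close by (simp add: d_def)
  have "\<bar>\<Sum>q<n. T (real q * d) ?r\<bar> \<le> real n *\<^sub>R d *\<^sub>R \<epsilon> *\<^sub>R W"
  proof (rule abs_sum_le)
    fix q
    assume "q < n"
    then have q: "0 \<le> real q * d" "real q * d \<le> s"
      using node_bounds[of s q n] assms(1) by (auto simp: d_def)
    have "\<bar>T (real q * d) ?r\<bar> \<le> T (real q * d) (d *\<^sub>R \<epsilon> *\<^sub>R u)"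
      using q(1) r by (rule abs_T_le)
    also have "\<dots> = d *\<^sub>R \<epsilon> *\<^sub>R T (real q * d) u" using q(1) by (simp add: T_linear_simps)
    also have "\<dots> \<le> d *\<^sub>R \<epsilon> *\<^sub>R W"
      using W[OF q] d \<open>\<epsilon> \<ge> 0\<close> abs_ge_self by (intro scaleR_left_mono) (auto intro: order_trans)
    finally show "\<bar>T (real q * d) ?r\<bar> \<le> d *\<^sub>R \<epsilon> *\<^sub>R W" .
  qed
  also have "real n *\<^sub>R d *\<^sub>R \<epsilon> *\<^sub>R W = \<epsilon> *\<^sub>R (s *\<^sub>R W)"
    using assms(2) by (simp add: d_def mult.commute)
  finally show ?thesis using diff by simp
qed

text \<open>
  The sums with \<open>n\<close> and \<open>m\<close> nodes are both compared with their common refinement with \<open>n * m\<close> nodes.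
\<close>

lemma ru_Cauchy_riemann_sum:
  assumes "s > 0"
  shows "ru_Cauchy (riemann_sum s x)"
proof -
  obtain u where u: "\<And>\<epsilon>. \<epsilon> > 0 \<Longrightarrow> \<exists>\<delta>>0. \<forall>h. 0 \<le> h \<and> h \<le> \<delta> \<longrightarrow> \<bar>T h x - x\<bar> \<le> \<epsilon> *\<^sub>R u"
    using orbit_continuous_at_0 by metis
  obtain W where W: "\<And>t. 0 \<le> t \<Longrightarrow> t \<le> s \<Longrightarrow> \<bar>T t u\<bar> \<le> W"
    using orbit_bounded by blast
  have "\<exists>N. \<forall>n\<ge>N. \<forall>m\<ge>N. \<bar>riemann_sum s x n - riemann_sum s x m\<bar> \<le> \<epsilon> *\<^sub>R ((2 * s) *\<^sub>R W)"
    if "\<epsilon> > 0" for \<epsilon>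
  proof -
    obtain \<delta> where \<delta>: "\<delta> > 0" "\<And>h. 0 \<le> h \<Longrightarrow> h \<le> \<delta> \<Longrightarrow> \<bar>T h x - x\<bar> \<le> \<epsilon> *\<^sub>R u"
      using u[OF \<open>\<epsilon> > 0\<close>] by blast
    obtain N where N: "\<And>n. n \<ge> N \<Longrightarrow> n > 0 \<and> s / real n \<le> \<delta>"
      using eventually_mesh_le[OF \<delta>(1)] unfolding eventually_sequentially by blast
    have refine: "\<bar>riemann_sum s x (n * m) - riemann_sum s x n\<bar> \<le> \<epsilon> *\<^sub>R (s *\<^sub>R W)"
      if "n \<ge> N" "m \<ge> N" for n m
    proof (rule riemann_sum_refine[OF _ _ _ _ W])
      show "\<bar>T r x - x\<bar> \<le> \<epsilon> *\<^sub>R u" if "0 \<le> r" "r \<le> s / real n" for r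
        using \<delta>(2)[of r] that N[OF \<open>n \<ge> N\<close>] by linarith
    qed (use N that \<open>\<epsilon> > 0\<close> assms in auto)
    have "\<bar>riemann_sum s x n - riemann_sum s x m\<bar> \<le> \<epsilon> *\<^sub>R ((2 * s) *\<^sub>R W)"
      if "n \<ge> N" "m \<ge> N" for n m
    proof -
      have "\<bar>(riemann_sum s x (n * m) - riemann_sum s x m) - (riemann_sum s x (n * m) - riemann_sum s x n)\<bar>
          \<le> \<epsilon> *\<^sub>R (s *\<^sub>R W) + \<epsilon> *\<^sub>R (s *\<^sub>R W)"
        using refine[OF that] refine[OF that(2,1)] by (intro abs_diff_le) (simp_all add: mult.commute)
      then show ?thesis by (simp add: algebra_simps flip: scaleR_add_left)
    qed
    then show ?thesis by blast
  qed
  then show ?thesis unfolding ru_Cauchy_def by blast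
qed

section \<open>The limit of the Riemann sums lies in the domain\<close>

text \<open>
  An approximate form of \<open>T h y - y = \<integral>\<^sub>0\<^sup>h (T s - I) T t x dt\<close> for \<open>y = \<integral>\<^sub>0\<^sup>s T t x dt\<close>. Applying \<open>T h\<close>
  moves the nodes \<open>k d\<close> to \<open>k d + h\<close>; rounding \<open>h\<close> down to the multiple \<open>j d\<close> costs at most \<open>\<eta> W\<close> per
  node. Then the shifted nodes are nodes again, and the sums over \<open>j, \<dots>, n + j - 1\<close> and
  \<open>0, \<dots>, n - 1\<close> differ by the sums over \<open>n, \<dots>, n + j - 1\<close> and \<open>0, \<dots>, j - 1\<close>.
\<close>

lemma riemann_sum_shift:
  fixes s h :: real and n :: nat
  defines "d \<equiv> s / real n"
  defines "j \<equiv> nat \<lfloor>h / d\<rfloor>"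
  assumes "s > 0" "n > 0" "h \<ge> 0" "\<eta> \<ge> 0"
    and close: "\<And>r. 0 \<le> r \<Longrightarrow> r \<le> d \<Longrightarrow> \<bar>T r x - x\<bar> \<le> \<eta> *\<^sub>R u"
    and W: "\<And>t. 0 \<le> t \<Longrightarrow> t \<le> s + h \<Longrightarrow> \<bar>T t u\<bar> \<le> W"
  shows "\<bar>T h (riemann_sum s x n) - riemann_sum s x n
      - d *\<^sub>R (\<Sum>k<j. T s (T (real k * d) x) - T (real k * d) x)\<bar> \<le> \<eta> *\<^sub>R (s *\<^sub>R W)"
proof -
  have d: "d > 0" "real n * d = s" using assms(3,4) by (auto simp: d_def)
  define r where "r = h - real j * d"
  have "real j \<le> h / d" "h / d < real j + 1" using d(1) assms(5) by (simp_all add: j_def)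
  then have r: "0 \<le> r" "r \<le> d" "real j * d \<le> h"
    using d(1) by (auto simp: r_def field_simps)
  define g where "g k = T (real k * d) x" for k :: nat
  have shift: "(\<Sum>k<n. g (k + j)) - (\<Sum>k<n. g k) = (\<Sum>k<j. g (k + n) - g k)"
  proof -
    \<comment> \<open>Both sides complete to the sum over \<open>0, \<dots>, n + j - 1\<close>, so \<open>j\<close> may exceed \<open>n\<close>.\<close>
    have split: "(\<Sum>k<a + b. g k) = (\<Sum>k<a. g k) + (\<Sum>k<b. g (k + a))" for a b
      by (induction b) (simp_all add: add.assoc add.commute)
    show ?thesis using split[of j n] split[of n j] by (simp add: sum_subtractf algebra_simps)
  qed
  have gn: "g (k + n) = T s (g k)" for k
    using T_add[of "real k * d" s x] d assms(3) by (simp add: g_def algebra_simps)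
  have "\<bar>T (h + real k * d) x - g (k + j)\<bar> \<le> \<eta> *\<^sub>R W" if "k < n" for k
  proof -
    have kd: "0 \<le> real k * d" "real k * d \<le> s"
      using node_bounds[of s k n] that assms(3) by (auto simp: d_def)
    let ?t = "real (k + j) * d"
    have t: "0 \<le> ?t" "?t \<le> s + h" using kd r d by (auto simp: algebra_simps)
    have "h + real k * d = ?t + r" by (simp add: r_def algebra_simps)
    then have "T (h + real k * d) x - g (k + j) = T ?t (T r x - x)"
      using t r by (simp add: T_add T_linear_simps g_def)
    also have "\<bar>\<dots>\<bar> \<le> T ?t (\<eta> *\<^sub>R u)" using t(1) close[OF r(1,2)] by (rule abs_T_le)
    also have "\<dots> = \<eta> *\<^sub>R T ?t u" using t(1) by (simp add: T_linear_simps)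
    also have "\<dots> \<le> \<eta> *\<^sub>R W"
      using W[OF t] assms(6) abs_ge_self by (intro scaleR_left_mono) (auto intro: order_trans)
    finally show ?thesis .
  qed
  then have "\<bar>d *\<^sub>R (\<Sum>k<n. T (h + real k * d) x - g (k + j))\<bar> \<le> s *\<^sub>R \<eta> *\<^sub>R W"
    unfolding d_def using assms(3,4) by (intro abs_mesh_sum_le) auto
  also have "d *\<^sub>R (\<Sum>k<n. T (h + real k * d) x - g (k + j)) =
      T h (riemann_sum s x n) - riemann_sum s x n - d *\<^sub>R ((\<Sum>k<n. g (k + j)) - (\<Sum>k<n. g k))"
    using assms(5) d(1)
    by (simp add: riemann_sum_def d_def[symmetric] g_def T_linear_simps T_add sum_subtractf
        algebra_simps)
  also have "\<dots> = T h (riemann_sum s x n) - riemann_sum s x n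
      - d *\<^sub>R (\<Sum>k<j. T s (T (real k * d) x) - T (real k * d) x)"
    unfolding shift gn by (simp add: g_def)
  finally show ?thesis by (simp add: mult.commute)
qed

text \<open>
  The derivative at \<open>0\<close> of \<open>T h y\<close> is \<open>T s x - x\<close>. After \<open>riemann_sum_shift\<close>, three errors remain: the
  cost of rounding \<open>h\<close>, the distance of \<open>T (k d) x\<close> from \<open>x\<close> for \<open>k d \<le> h\<close>, and the remainder
  \<open>h - j d\<close>. The first and third are multiples of \<open>\<eta>\<close> and disappear in the limit of fine meshes, which
  leaves the bound \<open>h \<epsilon> (T s u + u)\<close>.
\<close>

lemma riemann_limit_in_domain:
  assumes "s > 0" and lim: "ru_tendsto (riemann_sum s x) y sequentially"
  shows "y \<in> generator_domain T"
proof -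
  let ?z = "T s x - x"
  obtain u where u: "u \<ge> 0"
    "\<And>\<epsilon>. \<epsilon> > 0 \<Longrightarrow> \<exists>\<delta>>0. \<forall>h. 0 \<le> h \<and> h \<le> \<delta> \<longrightarrow> \<bar>T h x - x\<bar> \<le> \<epsilon> *\<^sub>R u"
    using orbit_continuous_at_0 by metis
  let ?v = "T s u + u"
  have v: "?v \<ge> 0" using u(1) T_nonneg[of s u] assms(1) by simp
  have estimate: "\<bar>T h y - y - h *\<^sub>R ?z\<bar> \<le> h *\<^sub>R \<epsilon> *\<^sub>R ?v"
    if "\<epsilon> > 0" "0 < h" "h \<le> \<delta>"
      and \<delta>: "\<And>h. 0 \<le> h \<Longrightarrow> h \<le> \<delta> \<Longrightarrow> \<bar>T h x - x\<bar> \<le> \<epsilon> *\<^sub>R u" for \<epsilon> h \<delta>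
  proof -
    obtain W where W: "\<And>t. 0 \<le> t \<Longrightarrow> t \<le> s + h \<Longrightarrow> \<bar>T t u\<bar> \<le> W"
      using orbit_bounded by blast
    show ?thesis
    proof (rule ru_limit_abs_diff_le)
      show "ru_tendsto (\<lambda>n. T h (riemann_sum s x n) - riemann_sum s x n) (T h y - y) sequentially"
        using ru_tendsto_diff[OF ru_tendsto_T[OF _ lim] lim] that(2) by simp
      fix \<eta> :: real
      assume \<eta>: "\<eta> > 0"
      obtain \<gamma> where \<gamma>: "\<gamma> > 0" "\<And>h. 0 \<le> h \<Longrightarrow> h \<le> \<gamma> \<Longrightarrow> \<bar>T h x - x\<bar> \<le> \<eta> *\<^sub>R u"
        using u(2)[OF \<eta>] by blast
      \<comment> \<open>A mesh below \<open>\<gamma>\<close> controls the rounding of \<open>h\<close> at the nodes, one below \<open>\<eta>\<close> the remainder \<open>h - j d\<close>.\<close>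
      have "min \<gamma> \<eta> > 0" using \<gamma>(1) \<eta> by simp
      from eventually_mesh_le[OF this, of s]
      show "\<forall>\<^sub>F n in sequentially. \<bar>T h (riemann_sum s x n) - riemann_sum s x n - h *\<^sub>R ?z\<bar>
          \<le> h *\<^sub>R \<epsilon> *\<^sub>R ?v + \<eta> *\<^sub>R (s *\<^sub>R W + \<bar>?z\<bar>)"
      proof eventually_elim
        case (elim n)
        define d where "d = s / real n"
        define j where "j = nat \<lfloor>h / d\<rfloor>"
        have d: "d > 0" "d \<le> \<gamma>" "d \<le> \<eta>" using elim assms(1) by (auto simp: d_def)
        have "real j \<le> h / d" "h / d < real j + 1" using d(1) that(2) by (simp_all add: j_def)
        then have j: "real j * d \<le> h" "h - real j * d \<le> \<eta>"
          using d(1,3) by (auto simp: field_simps)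
        let ?S = "\<Sum>k<j. T s (T (real k * d) x) - T (real k * d) x"
        have 1: "\<bar>T h (riemann_sum s x n) - riemann_sum s x n - d *\<^sub>R ?S\<bar> \<le> \<eta> *\<^sub>R (s *\<^sub>R W)"
          unfolding d_def j_def
        proof (rule riemann_sum_shift[OF _ _ _ _ _ W])
          show "\<bar>T r x - x\<bar> \<le> \<eta> *\<^sub>R u" if "0 \<le> r" "r \<le> s / real n" for r
            using \<gamma>(2)[of r] that d(2) by (simp add: d_def)
        qed (use assms elim that(2) \<eta> in auto)
        have "\<bar>(T s (T (real k * d) x) - T (real k * d) x) - ?z\<bar> \<le> \<epsilon> *\<^sub>R ?v" if "k < j" for k
        proof -
          have "real k * d \<le> real j * d" using that d(1) by (intro mult_right_mono) auto
          then have "real k * d \<le> \<delta>" using j(1) \<open>h \<le> \<delta>\<close> by linarith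
          then have "\<bar>T (real k * d) x - x\<bar> \<le> \<epsilon> *\<^sub>R u"
            using d(1) by (intro \<delta>) auto
          then have "\<bar>T s (T (real k * d) x - x) - (T (real k * d) x - x)\<bar> \<le> T s (\<epsilon> *\<^sub>R u) + \<epsilon> *\<^sub>R u"
            using assms(1) by (intro abs_diff_le abs_T_le) auto
          then show ?thesis using assms(1) by (simp add: T_linear_simps algebra_simps)
        qed
        then have "\<bar>d *\<^sub>R (\<Sum>k<j. (T s (T (real k * d) x) - T (real k * d) x) - ?z)\<bar>
            \<le> d *\<^sub>R real j *\<^sub>R \<epsilon> *\<^sub>R ?v"
          using d(1) by (intro abs_scaleR_le abs_sum_le) auto
        also have "\<dots> = (real j * d) *\<^sub>R \<epsilon> *\<^sub>R ?v" by (simp add: mult.commute)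
        also have "\<dots> \<le> h *\<^sub>R \<epsilon> *\<^sub>R ?v"
          using j(1) v \<open>\<epsilon> > 0\<close> by (intro scaleR_right_mono scaleR_nonneg_nonneg) auto
        also have "d *\<^sub>R (\<Sum>k<j. (T s (T (real k * d) x) - T (real k * d) x) - ?z) =
            d *\<^sub>R ?S - (real j * d) *\<^sub>R ?z"
          by (simp add: sum_subtractf sum_constant_scaleR scaleR_diff_right mult.commute)
        finally have 2: "\<bar>d *\<^sub>R ?S - (real j * d) *\<^sub>R ?z\<bar> \<le> h *\<^sub>R \<epsilon> *\<^sub>R ?v" .
        have "\<bar>(h - real j * d) *\<^sub>R ?z\<bar> \<le> (h - real j * d) *\<^sub>R \<bar>?z\<bar>"
          using j(1) by (intro abs_scaleR_le) auto
        also have "\<dots> \<le> \<eta> *\<^sub>R \<bar>?z\<bar>" using j(2) by (intro scaleR_right_mono) auto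
        finally have 3: "\<bar>(h - real j * d) *\<^sub>R ?z\<bar> \<le> \<eta> *\<^sub>R \<bar>?z\<bar>" .
        have "T h (riemann_sum s x n) - riemann_sum s x n - h *\<^sub>R ?z =
            (T h (riemann_sum s x n) - riemann_sum s x n - d *\<^sub>R ?S)
            + (d *\<^sub>R ?S - (real j * d) *\<^sub>R ?z) - (h - real j * d) *\<^sub>R ?z"
          by (simp add: scaleR_diff_left)
        also have "\<bar>\<dots>\<bar> \<le> \<eta> *\<^sub>R (s *\<^sub>R W) + h *\<^sub>R \<epsilon> *\<^sub>R ?v + \<eta> *\<^sub>R \<bar>?z\<bar>"
          using abs_diff_le[OF abs_add_le[OF 1 2] 3] .
        also have "\<dots> = h *\<^sub>R \<epsilon> *\<^sub>R ?v + \<eta> *\<^sub>R (s *\<^sub>R W + \<bar>?z\<bar>)"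
          by (simp only: scaleR_add_right ac_simps)
        finally show ?case .
      qed
    qed simp
  qed
  have "ru_tendsto (difference_quotient T y) ?z (at_right 0)"
    unfolding ru_tendsto_difference_quotient_iff
  proof (intro exI[of _ ?v] allI impI)
    fix \<epsilon> :: real
    assume "\<epsilon> > 0"
    then obtain \<delta> where "\<delta> > 0" "\<And>h. 0 \<le> h \<Longrightarrow> h \<le> \<delta> \<Longrightarrow> \<bar>T h x - x\<bar> \<le> \<epsilon> *\<^sub>R u"
      using u(2) by blast
    then show "\<exists>\<delta>>0. \<forall>h. 0 < h \<and> h \<le> \<delta> \<longrightarrow> \<bar>T h y - y - h *\<^sub>R ?z\<bar> \<le> h *\<^sub>R \<epsilon> *\<^sub>R ?v"
      using estimate[OF \<open>\<epsilon> > 0\<close>, of _ \<delta>] by blast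
  qed
  then show ?thesis by (rule generator_eqI)
qed

section \<open>Properties of the generator\<close>

lemma operator_on_generator: "operator_on (generator_domain T) (generator T)"
proof -
  have add: "ru_tendsto (difference_quotient T (x + y)) (generator T x + generator T y) (at_right 0)"
    if "x \<in> generator_domain T" "y \<in> generator_domain T" for x y
  proof -
    have "ru_tendsto (\<lambda>h. difference_quotient T x h + difference_quotient T y h)
        (generator T x + generator T y) (at_right 0)"
      using that by (intro ru_tendsto_add ru_tendsto_generator)
    moreover have "\<forall>\<^sub>F h in at_right 0. difference_quotient T x h + difference_quotient T y h =
        difference_quotient T (x + y) h"
      using eventually_at_right_less[of 0]
      by eventually_elim (simp add: difference_quotient_def T_linear_simps algebra_simps)
    ultimately show ?thesis
      unfolding ru_tendsto_def by (elim ex_forward all_forward imp_forward) (auto elim: eventually_elim2)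
  qed
  have scale: "ru_tendsto (difference_quotient T (c *\<^sub>R x)) (c *\<^sub>R generator T x) (at_right 0)"
    if "x \<in> generator_domain T" for c x
  proof -
    have "ru_tendsto (\<lambda>h. c *\<^sub>R difference_quotient T x h) (c *\<^sub>R generator T x) (at_right 0)"
      using that by (intro ru_tendsto_scaleR ru_tendsto_generator)
    moreover have "\<forall>\<^sub>F h in at_right 0. c *\<^sub>R difference_quotient T x h =
        difference_quotient T (c *\<^sub>R x) h"
      using eventually_at_right_less[of 0]
      by eventually_elim (simp add: difference_quotient_def T_linear_simps algebra_simps)
    ultimately show ?thesis
      unfolding ru_tendsto_def by (elim ex_forward all_forward imp_forward) (auto elim: eventually_elim2)
  qed
  have "ru_tendsto (difference_quotient T 0) 0 (at_right 0)"
    unfolding ru_tendsto_difference_quotient_iff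
    by (intro exI[of _ 0]) (auto simp: linear_0[OF linear_T] intro!: exI[of _ 1])
  then have "0 \<in> generator_domain T" by (rule generator_eqI)
  then show ?thesis
    unfolding operator_on_def subspace_def using generator_eqI[OF add] generator_eqI[OF scale] by blast
qed

text \<open>
  Two limits are taken, with \<open>h\<close> fixed: the Riemann sums of the orbit of \<open>A (X n)\<close> converge to
  \<open>T h (X n) - X n\<close>, and then \<open>X n\<close> converges to \<open>x\<close>. The regulator of \<open>A (X n) \<rightarrow> y\<close> only
  contributes a multiple of \<open>\<eta>\<close>, so the final bound is uniform in \<open>h \<le> \<delta>\<close>.
\<close>

lemma ru_closed_generator: "ru_closed (generator_domain T) (generator T)"
  unfolding ru_closed_def
proof (intro allI impI, elim conjE)
  fix X x y
  assume dom: "\<forall>n. X n \<in> generator_domain T"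
    and X: "ru_tendsto X x sequentially"
    and AX: "ru_tendsto (\<lambda>n. generator T (X n)) y sequentially"
  obtain v where v: "\<And>\<eta>. \<eta> > 0 \<Longrightarrow> \<forall>\<^sub>F n in sequentially. \<bar>generator T (X n) - y\<bar> \<le> \<eta> *\<^sub>R v"
    using AX unfolding ru_tendsto_def by blast
  obtain u where
    u: "\<And>\<epsilon>. \<epsilon> > 0 \<Longrightarrow> \<exists>\<delta>>0. \<forall>h. 0 \<le> h \<and> h \<le> \<delta> \<longrightarrow> \<bar>T h y - y\<bar> \<le> \<epsilon> *\<^sub>R u"
    using orbit_continuous_at_0 by metis
  have estimate: "\<bar>T h x - x - h *\<^sub>R y\<bar> \<le> h *\<^sub>R \<epsilon> *\<^sub>R u"
    if h: "0 < h" "h \<le> \<delta>"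
      and \<delta>: "\<And>h. 0 \<le> h \<Longrightarrow> h \<le> \<delta> \<Longrightarrow> \<bar>T h y - y\<bar> \<le> \<epsilon> *\<^sub>R u" for \<epsilon> h \<delta>
  proof -
    obtain W where W: "\<And>t. 0 \<le> t \<Longrightarrow> t \<le> h \<Longrightarrow> \<bar>T t v\<bar> \<le> W"
      using orbit_bounded by blast
    show ?thesis
    proof (rule ru_limit_abs_diff_le)
      show "ru_tendsto (\<lambda>n. T h (X n) - X n) (T h x - x) sequentially"
        using ru_tendsto_diff[OF ru_tendsto_T[OF _ X] X] h by simp
      fix \<eta> :: real
      assume \<eta>: "\<eta> > 0"
      show "\<forall>\<^sub>F n in sequentially. \<bar>T h (X n) - X n - h *\<^sub>R y\<bar> \<le> h *\<^sub>R \<epsilon> *\<^sub>R u + \<eta> *\<^sub>R h *\<^sub>R W"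
        using v[OF \<eta>]
      proof eventually_elim
        case (elim n)
        let ?z = "generator T (X n)"
        have orbit: "\<bar>T t ?z - y\<bar> \<le> \<eta> *\<^sub>R W + \<epsilon> *\<^sub>R u" if t: "0 \<le> t" "t \<le> h" for t
        proof -
          have "\<bar>T t (?z - y)\<bar> \<le> T t (\<eta> *\<^sub>R v)" using t(1) elim by (rule abs_T_le)
          also have "\<dots> = \<eta> *\<^sub>R T t v" using t(1) by (simp add: T_linear_simps)
          also have "\<dots> \<le> \<eta> *\<^sub>R W"
            using W[OF t] \<eta> abs_ge_self by (intro scaleR_left_mono) (auto intro: order_trans)
          finally have "\<bar>T t (?z - y) + (T t y - y)\<bar> \<le> \<eta> *\<^sub>R W + \<epsilon> *\<^sub>R u"
            using t h by (intro abs_add_le \<delta>) auto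
          then show ?thesis using t(1) by (simp add: T_linear_simps)
        qed
        have "\<bar>T h (X n) - X n - h *\<^sub>R y\<bar> \<le> h *\<^sub>R (\<eta> *\<^sub>R W + \<epsilon> *\<^sub>R u)"
        proof (rule ru_limit_abs_diff_le)
          show "ru_tendsto (riemann_sum h ?z) (T h (X n) - X n) sequentially"
            using riemann_sum_generator[OF h(1)] dom by blast
          show "\<forall>\<^sub>F m in sequentially.
              \<bar>riemann_sum h ?z m - h *\<^sub>R y\<bar> \<le> h *\<^sub>R (\<eta> *\<^sub>R W + \<epsilon> *\<^sub>R u) + \<zeta> *\<^sub>R 0" for \<zeta>
            using eventually_gt_at_top[of 0]
          proof eventually_elim
            case (elim m)
            then show ?case using abs_riemann_sum_le[OF _ elim orbit] h(1) by simp
          qed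
        qed simp
        then show ?case by (simp add: scaleR_add_right mult.commute add.commute)
      qed
    qed simp
  qed
  have "ru_tendsto (difference_quotient T x) y (at_right 0)"
    unfolding ru_tendsto_difference_quotient_iff
  proof (intro exI[of _ u] allI impI)
    fix \<epsilon> :: real
    assume "\<epsilon> > 0"
    then obtain \<delta> where "\<delta> > 0" "\<And>h. 0 \<le> h \<Longrightarrow> h \<le> \<delta> \<Longrightarrow> \<bar>T h y - y\<bar> \<le> \<epsilon> *\<^sub>R u"
      using u by blast
    then show "\<exists>\<delta>>0. \<forall>h. 0 < h \<and> h \<le> \<delta> \<longrightarrow> \<bar>T h x - x - h *\<^sub>R y\<bar> \<le> h *\<^sub>R \<epsilon> *\<^sub>R u"
      using estimate[of _ \<delta> \<epsilon>] by blast
  qed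
  then show "x \<in> generator_domain T \<and> generator T x = y" using generator_eqI by blast
qed

end

text \<open>
  The approximants are the means \<open>(1 / s) \<integral>\<^sub>0\<^sup>s T t x dt\<close> for \<open>s = 1 / (i + 1)\<close>, whose existence is
  the point where ru-completeness enters. They inherit the regulator of the orbit of \<open>x\<close> at \<open>0\<close>.
\<close>

lemma ru_dense_generator_domain:
  fixes T :: "real \<Rightarrow> 'a::ru_complete_archimedean_vector_lattice \<Rightarrow> 'a"
  assumes "positive_ru_continuous_semigroup T"
  shows "ru_dense (generator_domain T)"
  unfolding ru_dense_def
proof
  fix x
  interpret positive_ru_semigroup T by standard (rule assms)
  obtain u where
    u: "\<And>\<epsilon>. \<epsilon> > 0 \<Longrightarrow> \<exists>\<delta>>0. \<forall>h. 0 \<le> h \<and> h \<le> \<delta> \<longrightarrow> \<bar>T h x - x\<bar> \<le> \<epsilon> *\<^sub>R u"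
    using orbit_continuous_at_0 by metis
  define s where "s i = 1 / real (Suc i)" for i
  have s: "s i > 0" for i by (simp add: s_def)
  have "\<exists>y. ru_tendsto (riemann_sum (s i) x) y sequentially" for i
    using ru_Cauchy_riemann_sum[OF s] by (rule ru_complete)
  then obtain Y where Y: "\<And>i. ru_tendsto (riemann_sum (s i) x) (Y i) sequentially"
    by metis
  define X where "X i = (1 / s i) *\<^sub>R Y i" for i
  have "X i \<in> generator_domain T" for i
    unfolding X_def using riemann_limit_in_domain[OF s Y] operator_on_generator
    by (auto simp: operator_on_def subspace_def)
  moreover have "\<forall>\<^sub>F i in sequentially. \<bar>X i - x\<bar> \<le> \<epsilon> *\<^sub>R u" if \<epsilon>: "\<epsilon> > 0" for \<epsilon>
  proof -
    obtain \<delta> where \<delta>: "\<delta> > 0" "\<And>h. 0 \<le> h \<Longrightarrow> h \<le> \<delta> \<Longrightarrow> \<bar>T h x - x\<bar> \<le> \<epsilon> *\<^sub>R u"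
      using u[OF \<epsilon>] by blast
    have "s \<longlonglongrightarrow> 0" unfolding s_def using LIMSEQ_inverse_real_of_nat by (simp add: inverse_eq_divide)
    then have "\<forall>\<^sub>F i in sequentially. s i < \<delta>" using \<delta>(1) by (rule order_tendstoD)
    then show ?thesis
    proof eventually_elim
      case (elim i)
      have "\<bar>Y i - s i *\<^sub>R x\<bar> \<le> s i *\<^sub>R \<epsilon> *\<^sub>R u"
      proof (rule ru_limit_abs_diff_le[OF _ Y])
        show "\<forall>\<^sub>F n in sequentially.
            \<bar>riemann_sum (s i) x n - s i *\<^sub>R x\<bar> \<le> s i *\<^sub>R \<epsilon> *\<^sub>R u + \<zeta> *\<^sub>R 0" for \<zeta>
          using eventually_gt_at_top[of 0]
        proof eventually_elim
          case (elim n)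
          then show ?case
            using abs_riemann_sum_le[of "s i" n x x "\<epsilon> *\<^sub>R u"] s[of i] \<open>s i < \<delta>\<close> \<delta>(2) by simp
        qed
      qed simp
      then have "\<bar>(1 / s i) *\<^sub>R (Y i - s i *\<^sub>R x)\<bar> \<le> (1 / s i) *\<^sub>R s i *\<^sub>R \<epsilon> *\<^sub>R u"
        using s[of i] by (intro abs_scaleR_le) auto
      then show ?case using s[of i] by (simp add: X_def scaleR_diff_right)
    qed
  qed
  ultimately show "\<exists>X. (\<forall>n. X n \<in> generator_domain T) \<and> ru_tendsto X x sequentially"
    unfolding ru_tendsto_def by blast
qed

theorem proposition4p7:
  fixes T :: "real \<Rightarrow> 'a::ru_complete_archimedean_vector_lattice \<Rightarrow> 'a"
  assumes "positive_ru_continuous_semigroup T"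
  shows "operator_on (generator_domain T) (generator T) \<and>
    ru_densely_defined (generator_domain T) (generator T) \<and>
    ru_closed (generator_domain T) (generator T)"
proof -
  interpret positive_ru_semigroup T by standard (rule assms)
  show ?thesis
    unfolding ru_densely_defined_def
    using operator_on_generator ru_dense_generator_domain[OF assms] ru_closed_generator by blast
qed

end
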